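(* Let $\lambda$ be a regular uncountable cardinal and let $D$ be a weakly reasonable uniform ultrafilter on $\lambda$. Then $D$ is a regular ultrafilter, i.e., there is a family $\{A_\varepsilon:\varepsilon<\lambda\}\subseteq D$ such that every $\alpha<\lambda$ belongs to only finitely many of the sets $A_\varepsilon$.
   Context: A uniform ultrafilter on $\lambda$ is an ultrafilter all of whose members have cardinality $\lambda$. $\mathcal{F}_\lambda$ denotes the family of all non-decreasing unbounded functions from $\lambda$ to $\lambda$. A uniform ultrafilter $D$ on $\lambda$ is weakly reasonable if for every $f\in\mathcal{F}_\lambda$ there is a club $C$ of $\lambda$ such that $\bigcup\{[\delta,\delta+f(\delta)):\delta\in C\}\notin D$. *)

theory Defs
  imports Main
begin

unbundle cardinal_syntax

text \<open>
  The cardinal \<open>\<lambda>\<close> is a type \<open>'a::wellorder\<close>: its elements are the ordinals below \<open>\<lambda>\<close>.  That the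
  order type of \<open>'a\<close> really is a regular uncountable cardinal is expressed with the library's
  cardinals, which are well-order relations.
\<close>

definition ord_rel :: "'a::wellorder rel" where
  "ord_rel = relation_of (\<le>) UNIV"

definition regular_uncountable :: "'a rel \<Rightarrow> bool" where
  "regular_uncountable r \<longleftrightarrow> Card_order r \<and> regularCard r \<and> natLeq <o r"

text \<open>
  Ordinal addition, by the usual recursion \<open>\<delta> + \<beta> = sup ({\<delta>} \<union> {(\<delta> + \<gamma>) + 1 | \<gamma> < \<beta>})\<close>.  The least
  element exists when the order type is an infinite regular cardinal; see \<open>ord_add_rec\<close> below.
\<close>

function ord_add :: "'a::wellorder \<Rightarrow> 'a \<Rightarrow> 'a" where
  "ord_add \<delta> \<beta> = (LEAST \<xi>. \<delta> \<le> \<xi> \<and> (\<forall>\<gamma>\<in>{..<\<beta>}. ord_add \<delta> \<gamma> < \<xi>))"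
  by auto
termination
  by (relation "inv_image {(x, y). x < y} snd") (auto intro: wf)

declare ord_add.simps [simp del]

definition club :: "'a::wellorder set \<Rightarrow> bool" where
  "club C \<longleftrightarrow> \<not> bdd_above C \<and>
     (\<forall>\<delta>. (\<exists>\<beta>. \<beta> < \<delta>) \<and> (\<forall>\<beta><\<delta>. \<exists>\<gamma>\<in>C. \<beta> < \<gamma> \<and> \<gamma> < \<delta>) \<longrightarrow> \<delta> \<in> C)"

definition unbounded_mono_funs :: "('a::wellorder \<Rightarrow> 'a) set" where
  "unbounded_mono_funs = {f. mono f \<and> \<not> bdd_above (range f)}"

text \<open>
  A set \<open>A\<close> is a member of the filter \<open>D\<close> iff \<open>\<forall>\<^sub>F x in D. x \<in> A\<close>.
  The library's filters may be improper, hence \<open>D \<noteq> bot\<close>.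
\<close>

definition ultrafilter :: "'a filter \<Rightarrow> bool" where
  "ultrafilter D \<longleftrightarrow> D \<noteq> bot \<and>
     (\<forall>A. (\<forall>\<^sub>F x in D. x \<in> A) \<or> (\<forall>\<^sub>F x in D. x \<in> - A))"

definition uniform_ultrafilter :: "'a::wellorder filter \<Rightarrow> bool" where
  "uniform_ultrafilter D \<longleftrightarrow> ultrafilter D \<and>
     (\<forall>A. (\<forall>\<^sub>F x in D. x \<in> A) \<longrightarrow> |A| =o (ord_rel :: 'a rel))"

definition weakly_reasonable :: "'a::wellorder filter \<Rightarrow> bool" where
  "weakly_reasonable D \<longleftrightarrow> uniform_ultrafilter D \<and>
     (\<forall>f\<in>unbounded_mono_funs. \<exists>C. club C \<and>
        \<not> (\<forall>\<^sub>F x in D. x \<in> (\<Union>\<delta>\<in>C. {\<delta>..<ord_add \<delta> (f \<delta>)})))"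

text \<open>Finiteness is of the set of indices, so the family \<open>A\<close> may have repetitions, but only finite ones.\<close>

definition regular_ultrafilter :: "'a::wellorder filter \<Rightarrow> bool" where
  "regular_ultrafilter D \<longleftrightarrow> ultrafilter D \<and>
     (\<exists>A :: 'a \<Rightarrow> 'a set. (\<forall>\<epsilon>. \<forall>\<^sub>F x in D. x \<in> A \<epsilon>) \<and> (\<forall>\<alpha>. finite {\<epsilon>. \<alpha> \<in> A \<epsilon>}))"

lemma Field_ord_rel: "Field (ord_rel :: 'a::wellorder rel) = UNIV"
  by (auto simp: ord_rel_def relation_of_def Field_def)

lemma ord_rel_iff: "(x, y) \<in> ord_rel \<longleftrightarrow> x \<le> y"
  by (simp add: ord_rel_def relation_of_def)

lemma ord_add_rec:
  fixes \<delta> \<beta> :: "'a::wellorder"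
  assumes "regular_uncountable (ord_rel :: 'a rel)"
  shows "\<delta> \<le> ord_add \<delta> \<beta> \<and> (\<forall>\<gamma><\<beta>. ord_add \<delta> \<gamma> < ord_add \<delta> \<beta>)"
proof -
  let ?r = "ord_rel :: 'a rel"
  let ?A = "ord_add \<delta> ` {..<\<beta>} \<union> {\<delta>}"
  have co: "Card_order ?r" and reg: "regularCard ?r" and unc: "natLeq <o ?r"
    using assms by (auto simp: regular_uncountable_def)
  have inf: "\<not> finite (Field ?r)"
    using unc co ordLess_imp_ordLeq infinite_iff_natLeq_ordLeq card_of_Field_ordIso
    by (metis ordIso_symmetric ordLeq_ordIso_trans)
  have "|underS ?r \<beta>| <o ?r"
    using co by (simp add: card_of_underS Field_ord_rel)
  moreover have "underS ?r \<beta> = {..<\<beta>}"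
    by (auto simp: underS_def ord_rel_iff)
  ultimately have "|{..<\<beta>}| <o ?r"
    by simp
  then have "|ord_add \<delta> ` {..<\<beta>}| <o ?r"
    using card_of_image ordLeq_ordLess_trans by blast
  moreover have "|{\<delta>}| <o ?r"
    using finite_ordLess_infinite[of "|{\<delta>}|" ?r] co inf
    by (simp add: card_of_well_order_on Field_card_of card_order_on_well_order_on)
  ultimately have "|?A| <o ?r"
    using card_of_Un_ordLess_infinite_Field[OF inf co] by blast
  then have "\<not> cofinal ?A ?r"
    using reg not_ordLess_ordIso by (auto simp: regularCard_def Field_ord_rel)
  then obtain a where "\<And>b. b \<in> ?A \<Longrightarrow> \<not> (a \<noteq> b \<and> a \<le> b)"
    unfolding cofinal_def by (auto simp only: ord_rel_iff Field_ord_rel)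
  then have a: "\<And>b. b \<in> ?A \<Longrightarrow> b \<le> a"
    by (metis linear)
  obtain a' where "a < a'"
    using infinite_Card_order_limit[OF co inf, of a] by (auto simp: Field_ord_rel ord_rel_iff less_le)
  then have "\<delta> \<le> a' \<and> (\<forall>\<gamma>\<in>{..<\<beta>}. ord_add \<delta> \<gamma> < a')"
    using a by (meson UnCI UnI1 imageI le_less_trans less_imp_le singletonI)
  from LeastI[of "\<lambda>\<xi>. \<delta> \<le> \<xi> \<and> (\<forall>\<gamma>\<in>{..<\<beta>}. ord_add \<delta> \<gamma> < \<xi>)", OF this]
  show ?thesis
    by (subst (1 3) ord_add.simps) auto
qed

end

theory Submission
  imports Defs "HOL-Library.Infinite_Set"
begin

text \<open>
  Call \<open>\<alpha>\<close> separated by \<open>C\<close> from \<open>E\<close> if some point of \<open>E\<close> below or equal to \<open>\<alpha>\<close> lies above all points of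
  \<open>C\<close> up to \<open>\<alpha>\<close>.  Weak reasonableness, applied to a function \<open>f\<close> that jumps past the next point of an
  unbounded set \<open>E\<close>, yields a club \<open>C\<close> that separates \<open>D\<close>-almost all \<open>\<alpha>\<close> from \<open>E\<close>.  Choose clubs
  \<open>C \<epsilon>\<close> recursively in this way for \<open>E \<epsilon> = (\<Inter>\<zeta><\<epsilon>. C \<zeta>)\<close>.  If \<open>\<alpha>\<close> is separated at stages
  \<open>\<epsilon> < \<epsilon>'\<close>, the witness for \<open>\<epsilon>'\<close> lies in \<open>C \<epsilon>\<close> and hence below the witness for \<open>\<epsilon>\<close>; as
  ordinals do not decrease infinitely often, \<open>\<alpha>\<close> is separated at finitely many stages only.
\<close>

text \<open>Regularity in the library's form: a cofinal set has full cardinality, so a smaller set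
  is not cofinal.\<close>

lemma regular_uncountable_bdd_above:
  fixes A :: "'a::wellorder set"
  assumes "regular_uncountable (ord_rel :: 'a rel)" and "|A| <o (ord_rel :: 'a rel)"
  shows "bdd_above A"
proof -
  have "\<not> cofinal A (ord_rel :: 'a rel)"
    using assms not_ordLess_ordIso by (auto simp: regular_uncountable_def regularCard_def Field_ord_rel)
  then obtain a where "\<And>b. b \<in> A \<Longrightarrow> \<not> (a \<noteq> b \<and> a \<le> b)"
    unfolding cofinal_def by (auto simp only: ord_rel_iff Field_ord_rel)
  then show ?thesis
    by (metis bdd_above.I linear)
qed

lemma card_of_lessThan:
  fixes a :: "'a::wellorder"
  assumes "regular_uncountable (ord_rel :: 'a rel)"
  shows "|{..<a}| <o (ord_rel :: 'a rel)"
proof -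
  have "|underS (ord_rel :: 'a rel) a| <o (ord_rel :: 'a rel)"
    using assms by (simp add: regular_uncountable_def card_of_underS Field_ord_rel)
  moreover have "underS (ord_rel :: 'a rel) a = {..<a}"
    by (auto simp: underS_def ord_rel_iff)
  ultimately show ?thesis
    by simp
qed

text \<open>Here uncountability enters: it ensures that sequences indexed by \<open>nat\<close> have
  suprema.\<close>

lemma bdd_above_range_nat:
  fixes x :: "nat \<Rightarrow> 'a::wellorder"
  assumes "regular_uncountable (ord_rel :: 'a rel)"
  shows "bdd_above (range x)"
proof -
  have "|range x| \<le>o natLeq"
    using card_of_image card_of_nat ordLeq_ordIso_trans by blast
  then have "|range x| <o (ord_rel :: 'a rel)"
    using assms ordLeq_ordLess_trans unfolding regular_uncountable_def by blast
  then show ?thesis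
    by (rule regular_uncountable_bdd_above[OF assms])
qed

lemma regular_uncountable_greater:
  fixes a :: "'a::wellorder"
  assumes "regular_uncountable (ord_rel :: 'a rel)"
  shows "\<exists>b. a < b"
proof -
  have co: "Card_order (ord_rel :: 'a rel)" and unc: "natLeq <o (ord_rel :: 'a rel)"
    using assms by (auto simp: regular_uncountable_def)
  have "\<not> finite (Field (ord_rel :: 'a rel))"
    using unc co ordLess_imp_ordLeq infinite_iff_natLeq_ordLeq card_of_Field_ordIso
    by (metis ordIso_symmetric ordLeq_ordIso_trans)
  from infinite_Card_order_limit[OF co this, of a] show ?thesis
    by (auto simp: Field_ord_rel ord_rel_iff less_le)
qed

lemma not_bdd_above_greater:
  fixes E :: "'a::linorder set"
  assumes "\<not> bdd_above E"
  shows "\<exists>\<xi>\<in>E. a < \<xi>"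
  using assms by (metis bdd_above.I not_le)

text \<open>Interleaving: iterate a map \<open>g\<close> such that every \<open>C \<zeta>\<close>
  has a point strictly between \<open>x\<close> and \<open>g x\<close>. The supremum of the iterates
  is then a limit of points of each \<open>C \<zeta>\<close>, so it lies in all of them.\<close>

lemma not_bdd_above_INT_club:
  fixes C :: "'a::wellorder \<Rightarrow> 'a set"
  assumes reg: "regular_uncountable (ord_rel :: 'a rel)"
    and club: "\<And>\<zeta>. \<zeta> < \<epsilon> \<Longrightarrow> club (C \<zeta>)"
  shows "\<not> bdd_above (\<Inter>\<zeta>\<in>{..<\<epsilon>}. C \<zeta>)"
proof
  assume "bdd_above (\<Inter>\<zeta>\<in>{..<\<epsilon>}. C \<zeta>)"
  then obtain b where b: "\<And>x. x \<in> (\<Inter>\<zeta>\<in>{..<\<epsilon>}. C \<zeta>) \<Longrightarrow> x \<le> b"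
    unfolding bdd_above_def by blast
  have "\<exists>y>x. \<forall>\<zeta><\<epsilon>. \<exists>c\<in>C \<zeta>. x < c \<and> c < y" for x
  proof -
    have "\<forall>\<zeta>\<in>{..<\<epsilon>}. \<exists>c. c \<in> C \<zeta> \<and> x < c"
      using club not_bdd_above_greater unfolding club_def by (metis lessThan_iff)
    then obtain c where c: "\<And>\<zeta>. \<zeta> < \<epsilon> \<Longrightarrow> c \<zeta> \<in> C \<zeta> \<and> x < c \<zeta>"
      by (metis lessThan_iff)
    \<comment> \<open>One point is chosen per club, fewer than \<lambda> in all, so regularity gives
      a common bound.\<close>
    have "|c ` {..<\<epsilon>}| <o (ord_rel :: 'a rel)"
      using card_of_image card_of_lessThan[OF reg] ordLeq_ordLess_trans by blast
    then obtain u where u: "\<And>\<zeta>. \<zeta> < \<epsilon> \<Longrightarrow> c \<zeta> \<le> u"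
      using regular_uncountable_bdd_above[OF reg] by (fastforce simp: bdd_above_def)
    \<comment> \<open>The maximum secures \<open>x < y\<close> even when no \<open>\<zeta>\<close>
      lies below \<open>\<epsilon>\<close>.\<close>
    obtain y where "max x u < y"
      using regular_uncountable_greater[OF reg] by blast
    then show ?thesis
      using c u by (metis le_less_trans max_less_iff_conj)
  qed
  then obtain g where g: "\<And>x. x < g x"
    and gC: "\<And>x \<zeta>. \<zeta> < \<epsilon> \<Longrightarrow> \<exists>c\<in>C \<zeta>. x < c \<and> c < g x"
    by metis
  define x where "x n = (g ^^ n) (g b)" for n
  have xS: "x (Suc n) = g (x n)" for n
    by (simp add: x_def)
  define \<delta> where "\<delta> = (LEAST u. \<forall>n. x n \<le> u)"
  have "\<exists>u. \<forall>n. x n \<le> u"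
    using bdd_above_range_nat[OF reg, of x] by (auto simp: bdd_above_def)
  then have up: "x n \<le> \<delta>" for n
    using LeastI_ex[of "\<lambda>u. \<forall>n. x n \<le> u"] unfolding \<delta>_def by blast
  have below: "\<exists>n. \<beta> < x n" if "\<beta> < \<delta>" for \<beta>
    using not_less_Least[OF that[unfolded \<delta>_def]] by (auto simp: not_le)
  have "x 0 < \<delta>"
    using up[of "Suc 0"] xS[of 0] g[of "x 0"] by simp
  have "\<delta> \<in> C \<zeta>" if \<zeta>: "\<zeta> < \<epsilon>" for \<zeta>
  proof -
    have "\<exists>c\<in>C \<zeta>. \<beta> < c \<and> c < \<delta>" if "\<beta> < \<delta>" for \<beta>
      by (metis below[OF that] gC[OF \<zeta>] xS up less_trans less_le_trans)
    then show ?thesis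
      using club[OF \<zeta>] \<open>x 0 < \<delta>\<close> by (auto simp: club_def)
  qed
  then have "\<delta> \<le> b"
    using b by auto
  then show False
    using g[of b] \<open>x 0 < \<delta>\<close> by (simp add: x_def)
qed

text \<open>The least upper bound of the points of \<open>C\<close> up to \<open>\<alpha>\<close>
  belongs to \<open>C\<close>, for otherwise it would be a limit of them.\<close>

lemma club_last_element:
  fixes C :: "'a::wellorder set"
  assumes "club C" and "c \<in> C" and "c \<le> \<alpha>"
  obtains \<delta> where "\<delta> \<in> C" and "\<delta> \<le> \<alpha>" and "\<And>c'. c' \<in> C \<Longrightarrow> c' \<le> \<alpha> \<Longrightarrow> c' \<le> \<delta>"
proof -
  define \<delta> where "\<delta> = (LEAST u. \<forall>c\<in>C. c \<le> \<alpha> \<longrightarrow> c \<le> u)"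
  have up: "c' \<le> \<delta>" if "c' \<in> C" "c' \<le> \<alpha>" for c'
    using LeastI[of "\<lambda>u. \<forall>c\<in>C. c \<le> \<alpha> \<longrightarrow> c \<le> u" \<alpha>] that by (auto simp: \<delta>_def)
  have le: "\<delta> \<le> \<alpha>"
    unfolding \<delta>_def by (rule Least_le) auto
  have "\<delta> \<in> C"
  proof (rule ccontr)
    assume n: "\<delta> \<notin> C"
    have "\<exists>\<gamma>\<in>C. \<beta> < \<gamma> \<and> \<gamma> < \<delta>" if "\<beta> < \<delta>" for \<beta>
      using not_less_Least[OF that[unfolded \<delta>_def]] up n by (metis le_less not_le)
    moreover have "c < \<delta>"
      using up assms(2,3) n by (metis le_less)
    ultimately show False
      using assms(1) n by (auto simp: club_def)
  qed
  then show thesis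
    using that up le by blast
qed

text \<open>\<open>ord_add \<delta>\<close> is strictly increasing, and a strictly increasing
  self-map of a well-order never falls below the identity.\<close>

lemma le_ord_add:
  fixes \<delta> \<beta> :: "'a::wellorder"
  assumes "regular_uncountable (ord_rel :: 'a rel)"
  shows "\<beta> \<le> ord_add \<delta> \<beta>"
proof (induction \<beta> rule: less_induct)
  case (less \<beta>)
  then show ?case
    using ord_add_rec[OF assms, of \<delta>] by (metis leD not_le)
qed

definition separated :: "'a::linorder set \<Rightarrow> 'a set \<Rightarrow> 'a set" where
  "separated E C = {\<alpha>. \<exists>\<xi>\<in>E. \<xi> \<le> \<alpha> \<and> (\<forall>c\<in>C. c \<le> \<alpha> \<longrightarrow> c < \<xi>)}"

text \<open>A proper initial segment is too small to be a member of \<open>D\<close>, so its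
  complement is one.\<close>

lemma uniform_ultrafilter_eventually_ge:
  fixes D :: "'a::wellorder filter"
  assumes "regular_uncountable (ord_rel :: 'a rel)" and "uniform_ultrafilter D"
  shows "\<forall>\<^sub>F x in D. a \<le> x"
proof -
  have "\<not> (\<forall>\<^sub>F x in D. x \<in> {..<a})"
    using assms card_of_lessThan not_ordLess_ordIso unfolding uniform_ultrafilter_def by blast
  then have "\<forall>\<^sub>F x in D. x \<in> - {..<a}"
    using assms(2) unfolding uniform_ultrafilter_def ultrafilter_def by blast
  then show ?thesis
    by (simp add: not_less)
qed

text \<open>Let \<open>\<delta>\<close> be the last point of \<open>C\<close> up to
  \<open>\<alpha>\<close>. If \<open>\<alpha>\<close> avoids the intervals, it is at least
  \<open>ord_add \<delta> (f \<delta>)\<close>, hence at least \<open>f \<delta>\<close>, which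
  exceeds a point of \<open>E\<close> above \<open>\<delta>\<close>.\<close>

lemma weakly_reasonable_separated:
  fixes D :: "'a::wellorder filter"
  assumes reg: "regular_uncountable (ord_rel :: 'a rel)"
    and D: "weakly_reasonable D" and E: "\<not> bdd_above E"
  shows "\<exists>C. club C \<and> (\<forall>\<^sub>F \<alpha> in D. \<alpha> \<in> separated E C)"
proof -
  \<comment> \<open>This is the successor of the first point of \<open>E\<close> beyond
    \<open>\<delta>\<close>.\<close>
  define f where "f \<delta> = (LEAST x. \<exists>\<xi>\<in>E. \<delta> < \<xi> \<and> \<xi> < x)" for \<delta>
  have f: "\<exists>\<xi>\<in>E. \<delta> < \<xi> \<and> \<xi> < f \<delta>" for \<delta>
    unfolding f_def
    using not_bdd_above_greater[OF E] regular_uncountable_greater[OF reg] by (rule_tac LeastI_ex) metis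
  have "mono f"
  proof
    fix \<delta> \<delta>' :: 'a
    assume "\<delta> \<le> \<delta>'"
    then show "f \<delta> \<le> f \<delta>'"
      unfolding f_def[of \<delta>] using f[of \<delta>'] by (metis (no_types, lifting) Least_le le_less_trans)
  qed
  moreover have "\<not> bdd_above (range f)"
    using f by (metis bdd_above.unfold less_trans not_le rangeI)
  ultimately have "f \<in> unbounded_mono_funs"
    by (simp add: unbounded_mono_funs_def)
  then obtain C where C: "club C"
    and nD: "\<not> (\<forall>\<^sub>F x in D. x \<in> (\<Union>\<delta>\<in>C. {\<delta>..<ord_add \<delta> (f \<delta>)}))"
    using D unfolding weakly_reasonable_def by blast
  have uni: "uniform_ultrafilter D"
    using D by (simp add: weakly_reasonable_def)
  with nD have ev: "\<forall>\<^sub>F x in D. x \<in> - (\<Union>\<delta>\<in>C. {\<delta>..<ord_add \<delta> (f \<delta>)})"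
    unfolding uniform_ultrafilter_def ultrafilter_def by blast
  obtain m where m: "m \<in> E"
    using E by fastforce
  have "\<forall>\<^sub>F \<alpha> in D. \<alpha> \<in> separated E C"
    using ev uniform_ultrafilter_eventually_ge[OF reg uni, of m]
  proof eventually_elim
    case (elim \<alpha>)
    show ?case
    proof (cases "\<exists>c\<in>C. c \<le> \<alpha>")
      case True
      then obtain \<delta> where \<delta>: "\<delta> \<in> C" "\<delta> \<le> \<alpha>" "\<And>c. c \<in> C \<Longrightarrow> c \<le> \<alpha> \<Longrightarrow> c \<le> \<delta>"
        using club_last_element[OF C] by metis
      obtain \<xi> where \<xi>: "\<xi> \<in> E" "\<delta> < \<xi>" "\<xi> < f \<delta>"
        using f by blast
      have "ord_add \<delta> (f \<delta>) \<le> \<alpha>"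
        using elim(1) \<delta>(1,2) by (auto simp: not_less)
      then have "\<xi> \<le> \<alpha>"
        using \<xi>(3) le_ord_add[OF reg, of "f \<delta>" \<delta>] by simp
      then show ?thesis
        using \<xi> \<delta>(3) unfolding separated_def by fastforce
    next
      case False
      \<comment> \<open>With no point of \<open>C\<close> up to \<open>\<alpha>\<close>, any point
        of \<open>E\<close> up to \<open>\<alpha>\<close> is a witness; \<open>m\<close> was fixed
        for this case.\<close>
      then show ?thesis
        using m elim(2) by (auto simp: separated_def)
    qed
  qed
  then show ?thesis
    using C by blast
qed

text \<open>An infinite \<open>S\<close> contains an increasing sequence, which \<open>\<xi>\<close>
  would turn into an infinite descent.\<close>

lemma finite_strict_antimono_wellorder:
  fixes S :: "'a::wellorder set" and \<xi> :: "'a \<Rightarrow> 'b::wellorder"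
  assumes "\<And>x y. x \<in> S \<Longrightarrow> y \<in> S \<Longrightarrow> x < y \<Longrightarrow> \<xi> y < \<xi> x"
  shows "finite S"
proof (rule ccontr)
  assume "infinite S"
  then have "\<xi> (enumerate S (Suc n)) < \<xi> (enumerate S n)" for n
    by (intro assms enumerate_in_set enumerate_step)
  then show False
    using wf_no_infinite_down_chainE[OF wf, of "\<lambda>n. \<xi> (enumerate S n)"] by blast
qed

theorem theorem2p8:
  fixes D :: "'a::wellorder filter"
  assumes "regular_uncountable (ord_rel :: 'a rel)"
    and "weakly_reasonable D"
  shows "regular_ultrafilter D"
proof -
  \<comment> \<open>Well-founded recursion with choice: the requirement at stage
    \<open>\<epsilon>\<close> depends only on earlier clubs, and some club always meets it. At the
    least stage the empty intersection is the whole type.\<close>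
  have "\<exists>C. \<forall>\<epsilon> :: 'a. club (C \<epsilon>) \<and> (\<forall>\<^sub>F \<alpha> in D. \<alpha> \<in> separated (\<Inter>\<zeta>\<in>{..<\<epsilon>}. C \<zeta>) (C \<epsilon>))"
  proof (rule dependent_wf_choice[OF wf, where P = "\<lambda>C (\<epsilon> :: 'a) c. club c \<and>
      (\<forall>\<^sub>F \<alpha> in D. \<alpha> \<in> separated (\<Inter>\<zeta>\<in>{..<\<epsilon>}. C \<zeta>) c)"])
    fix C C' :: "'a \<Rightarrow> 'a set" and \<epsilon> c
    assume "\<And>\<zeta>. (\<zeta>, \<epsilon>) \<in> {(x, y). x < y} \<Longrightarrow> C \<zeta> = C' \<zeta>"
    then have "(\<Inter>\<zeta>\<in>{..<\<epsilon>}. C \<zeta>) = (\<Inter>\<zeta>\<in>{..<\<epsilon>}. C' \<zeta>)"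
      by auto
    then show "(club c \<and> (\<forall>\<^sub>F \<alpha> in D. \<alpha> \<in> separated (\<Inter>\<zeta>\<in>{..<\<epsilon>}. C \<zeta>) c)) =
      (club c \<and> (\<forall>\<^sub>F \<alpha> in D. \<alpha> \<in> separated (\<Inter>\<zeta>\<in>{..<\<epsilon>}. C' \<zeta>) c))"
      by simp
  next
    fix \<epsilon> :: 'a and C
    assume "\<And>\<zeta>. (\<zeta>, \<epsilon>) \<in> {(x, y). x < y} \<Longrightarrow>
      club (C \<zeta>) \<and> (\<forall>\<^sub>F \<alpha> in D. \<alpha> \<in> separated (\<Inter>\<eta>\<in>{..<\<zeta>}. C \<eta>) (C \<zeta>))"
    then have "\<not> bdd_above (\<Inter>\<zeta>\<in>{..<\<epsilon>}. C \<zeta>)"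
      by (intro not_bdd_above_INT_club assms) simp
    then show "\<exists>c. club c \<and> (\<forall>\<^sub>F \<alpha> in D. \<alpha> \<in> separated (\<Inter>\<zeta>\<in>{..<\<epsilon>}. C \<zeta>) c)"
      by (rule weakly_reasonable_separated[OF assms])
  qed
  then obtain C where C: "\<And>\<epsilon> :: 'a. \<forall>\<^sub>F \<alpha> in D. \<alpha> \<in> separated (\<Inter>\<zeta>\<in>{..<\<epsilon>}. C \<zeta>) (C \<epsilon>)"
    by blast
  \<comment> \<open>These sets form the regularizing family; they are members of \<open>D\<close> by
    the choice of \<open>C\<close>, so only finiteness remains.\<close>
  have "finite {\<epsilon>. \<alpha> \<in> separated (\<Inter>\<zeta>\<in>{..<\<epsilon>}. C \<zeta>) (C \<epsilon>)}" (is "finite ?S") for \<alpha>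
  proof -
    have "\<forall>\<epsilon>\<in>?S. \<exists>\<xi>. \<xi> \<in> (\<Inter>\<zeta>\<in>{..<\<epsilon>}. C \<zeta>) \<and> \<xi> \<le> \<alpha> \<and> (\<forall>c\<in>C \<epsilon>. c \<le> \<alpha> \<longrightarrow> c < \<xi>)"
      unfolding separated_def by blast
    then obtain \<xi> where \<xi>: "\<forall>\<epsilon>\<in>?S. \<xi> \<epsilon> \<in> (\<Inter>\<zeta>\<in>{..<\<epsilon>}. C \<zeta>) \<and> \<xi> \<epsilon> \<le> \<alpha> \<and>
        (\<forall>c\<in>C \<epsilon>. c \<le> \<alpha> \<longrightarrow> c < \<xi> \<epsilon>)"
      by (rule bchoice[THEN exE])
    show ?thesis
    proof (rule finite_strict_antimono_wellorder)
      fix \<epsilon> \<epsilon>'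
      assume "\<epsilon> \<in> ?S" "\<epsilon>' \<in> ?S" "\<epsilon> < \<epsilon>'"
      then show "\<xi> \<epsilon>' < \<xi> \<epsilon>"
        using \<xi> by (meson INT_E lessThan_iff)
    qed
  qed
  moreover have "ultrafilter D"
    using assms(2) by (simp add: weakly_reasonable_def uniform_ultrafilter_def)
  ultimately show ?thesis
    using C unfolding regular_ultrafilter_def
    by (intro conjI exI[of _ "\<lambda>\<epsilon>. separated (\<Inter>\<zeta>\<in>{..<\<epsilon>}. C \<zeta>) (C \<epsilon>)"]) auto
qed

end
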